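(* Let $E$ be an AL-space and let $\mathcal{T} = (T_t)_{t \in J}$ be a bounded positive semigroup on $E$, where either $J = \mathbb{N}$ or $J = (0,\infty)$. Then for every $\varepsilon > 0$ the following assertions are equivalent: (i) The semigroup $\mathcal{T}$ converges strongly (as $t\to\infty$) to an operator $P$ such that $\|Pf\| \ge \varepsilon \|f\|$ for every $f \in E_+$. (ii) For every normalised $f \in E_+$ there is a lower bound $h_f$ for $(\mathcal{T},f)$ such that $\|h_f\| \ge \varepsilon$.
   Context: All spaces are real. $\mathbb{N} = \{1,2,\dots\}$. An AL-space is a Banach lattice $E$ with $\|f+g\| = \|f\|+\|g\|$ for all $f,g \in E_+$, where $E_+$ is the positive cone. A semigroup on $E$ is a family $(T_t)_{t \in J}$ of bounded linear operators on $E$ with $T_{t+s} = T_tT_s$ for all $s,t \in J$; no continuity in $t$ is assumed. It is bounded if $\sup_{t\in J}\|T_t\|<\infty$, and positive if $T_tE_+\subseteq E_+$ for all $t \in J$. Normalised means of norm $1$. Strong convergence means convergence in the strong operator topology to a bounded linear operator. For $f \in E_+$, a lower bound for $(\mathcal{T},f)$ is a vector $h_f \in E_+$ such that $\lim_{t\to\infty}\|(T_tf-h_f)^-\| = 0$; here $g^- = (-g)\vee 0$. *)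

theory Defs
  imports "HOL-Analysis.Analysis" "HOL-Library.Lattice_Algebras"
begin

class banach_lattice = banach + ordered_real_vector + lattice_ab_group_add_abs +
  assumes norm_mono_abs: "\<bar>x\<bar> \<le> \<bar>y\<bar> \<Longrightarrow> norm x \<le> norm y"

class al_space = banach_lattice +
  assumes norm_add_nonneg: "0 \<le> x \<Longrightarrow> 0 \<le> y \<Longrightarrow> norm (x + y) = norm x + norm y"

instance real :: al_space
  by standard auto

text \<open>
  The library's \<^const>\<open>nprt\<close> is \<open>inf x 0\<close>, i.e. the negative of the function below.
\<close>
definition neg_part :: "'a::banach_lattice \<Rightarrow> 'a" where
  "neg_part g = sup (- g) 0"

text \<open>
  Discrete and continuous time are treated together: the time set \<open>J\<close> is a set of reals and a
  family indexed by \<open>J\<close> is a function on the reals whose values outside \<open>J\<close> play no role.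
  Boundedness of each single operator is part of the type \<^typ>\<open>'a \<Rightarrow>\<^sub>L 'a\<close>.
\<close>
definition discrete_time :: "real set" where
  "discrete_time = real ` {1..}"

definition continuous_time :: "real set" where
  "continuous_time = {0<..}"

definition operator_semigroup ::
    "real set \<Rightarrow> (real \<Rightarrow> 'a::real_normed_vector \<Rightarrow>\<^sub>L 'a) \<Rightarrow> bool" where
  "operator_semigroup J T \<longleftrightarrow> (\<forall>s\<in>J. \<forall>t\<in>J. T (t + s) = T t o\<^sub>L T s)"

definition bounded_semigroup ::
    "real set \<Rightarrow> (real \<Rightarrow> 'a::real_normed_vector \<Rightarrow>\<^sub>L 'a) \<Rightarrow> bool" where
  "bounded_semigroup J T \<longleftrightarrow> operator_semigroup J T \<and> bdd_above ((\<lambda>t. norm (T t)) ` J)"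

definition positive_semigroup ::
    "real set \<Rightarrow> (real \<Rightarrow> 'a::banach_lattice \<Rightarrow>\<^sub>L 'a) \<Rightarrow> bool" where
  "positive_semigroup J T \<longleftrightarrow>
     operator_semigroup J T \<and> (\<forall>t\<in>J. \<forall>f\<ge>0. 0 \<le> blinfun_apply (T t) f)"

definition at_top_in :: "real set \<Rightarrow> real filter" where
  "at_top_in J = inf at_top (principal J)"

definition converges_strongly_to ::
    "real set \<Rightarrow> (real \<Rightarrow> 'a::real_normed_vector \<Rightarrow>\<^sub>L 'a) \<Rightarrow> ('a \<Rightarrow>\<^sub>L 'a) \<Rightarrow> bool" where
  "converges_strongly_to J T P \<longleftrightarrow> limitin strong_operator_topology T P (at_top_in J)"

definition is_lower_bound ::
    "real set \<Rightarrow> (real \<Rightarrow> 'a::banach_lattice \<Rightarrow>\<^sub>L 'a) \<Rightarrow> 'a \<Rightarrow> 'a \<Rightarrow> bool" where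
  "is_lower_bound J T f h \<longleftrightarrow>
     0 \<le> h \<and> ((\<lambda>t. norm (neg_part (blinfun_apply (T t) f - h))) \<longlongrightarrow> 0) (at_top_in J)"

lemma eventually_at_top_in:
  "eventually Q (at_top_in J) \<longleftrightarrow> (\<exists>t0. \<forall>t\<in>J. t0 \<le> t \<longrightarrow> Q t)"
  unfolding at_top_in_def eventually_inf_principal eventually_at_top_linorder by blast

lemma at_top_in_nontrivial:
  "at_top_in discrete_time \<noteq> bot" "at_top_in continuous_time \<noteq> bot"
proof -
  have "\<exists>t\<in>discrete_time. t0 \<le> t" for t0
  proof -
    obtain n :: nat where "t0 \<le> real n" using real_arch_simple by blast
    then show ?thesis
      unfolding discrete_time_def by (intro bexI[of _ "real (Suc n)"] imageI) auto
  qed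
  then show "at_top_in discrete_time \<noteq> bot"
    unfolding trivial_limit_def eventually_at_top_in by blast
  have "\<exists>t\<in>continuous_time. t0 \<le> t" for t0
    by (intro bexI[of _ "max t0 1"]) (auto simp: continuous_time_def)
  then show "at_top_in continuous_time \<noteq> bot"
    unfolding trivial_limit_def eventually_at_top_in by blast
qed

lemma converges_strongly_to_iff:
  "converges_strongly_to J T P \<longleftrightarrow>
     (\<forall>f. ((\<lambda>t. blinfun_apply (T t) f) \<longlongrightarrow> blinfun_apply P f) (at_top_in J))"
proof
  assume L: "converges_strongly_to J T P"
  show "\<forall>f. ((\<lambda>t. blinfun_apply (T t) f) \<longlongrightarrow> blinfun_apply P f) (at_top_in J)"
  proof
    fix f
    show "((\<lambda>t. blinfun_apply (T t) f) \<longlongrightarrow> blinfun_apply P f) (at_top_in J)"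
      using continuous_map_limit[OF strong_operator_topology_continuous_evaluation[of f]
          L[unfolded converges_strongly_to_def]]
      by (simp add: o_def)
  qed
next
  assume R: "\<forall>f. ((\<lambda>t. blinfun_apply (T t) f) \<longlongrightarrow> blinfun_apply P f) (at_top_in J)"
  have "limitin euclidean (\<lambda>t. blinfun_apply (T t)) (blinfun_apply P) (at_top_in J)"
    using R unfolding euclidean_product_topology[symmetric] limitin_componentwise
    by (simp add: extensional_def)
  then show "converges_strongly_to J T P"
    unfolding converges_strongly_to_def limitin_def strong_operator_topology_def
      topspace_pullback_topology openin_pullback_topology
    by auto
qed

end

theory Submission
  imports Defs
begin

text \<open>
  If the semigroup converges strongly to \<open>P\<close>, then \<open>P f\<close> itself is a lower bound of \<open>f\<close>. The
  content lies in the converse. Assume that every \<open>f \<ge> 0\<close> has a lower bound of norm at least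
  \<open>\<epsilon> * norm f\<close>, and let \<open>M\<close> bound the norms of the operators.

  The lower bounds of a fixed \<open>f\<close> form a norm-closed and norm-bounded set of positive vectors that is
  stable under suprema. Since the norm of an AL-space is additive on the cone, such a set has a
  greatest element \<open>h\<close> (\<open>bounded_sup_closed_set_has_greatest\<close>). The semigroup maps lower bounds of
  \<open>f\<close> to lower bounds of \<open>f\<close>, so \<open>T s h \<le> h\<close>. Hence the orbit of \<open>h\<close> decreases, and by additivity
  of the norm it converges to a fixed vector \<open>k\<close>, which is again a lower bound of \<open>f\<close>. Applying the
  hypothesis to \<open>h\<close> shows that \<open>k\<close> cannot be small: every lower bound of \<open>h\<close> lies below the limit
  \<open>k\<close> of its orbit, so \<open>norm k \<ge> \<epsilon> * norm h \<ge> \<epsilon>\<^sup>2 * norm f\<close> (\<open>fixed_lower_bound\<close>).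

  So a definite fraction of every positive vector can be split off as a fixed vector: for late times
  \<open>T t f\<close> is the sum of \<open>k\<close>, a positive remainder \<open>g\<close> and a small error. Now split \<open>g\<close> in the same
  way, and repeat. The fixed parts add up, and their norms add up as well, but the total cannot exceed
  \<open>M * norm f\<close>; therefore the remainder must eventually become small. The orbit of \<open>f\<close> thus comes
  arbitrarily close to fixed vectors, and since the semigroup is bounded it stays close to them, which
  makes it a Cauchy net (\<open>orbit_near_fixed_plus_remainder\<close>, \<open>orbit_converges\<close>). Finally
  every lower bound of \<open>f\<close> lies below the limit \<open>P f\<close>, which gives the sharp constant \<open>\<epsilon>\<close>
  for \<open>P\<close>, although the argument passed through \<open>\<epsilon>\<^sup>2\<close>.
\<close>

section \<open>The negative part and the norm of a Banach lattice\<close>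

lemma neg_part_nonneg: "0 \<le> neg_part (x::'a::banach_lattice)"
  by (simp add: neg_part_def)

lemma minus_le_neg_part: "- x \<le> neg_part (x::'a::banach_lattice)"
  by (simp add: neg_part_def)

lemma add_neg_part_nonneg: "0 \<le> x + neg_part (x::'a::banach_lattice)"
  using add_left_mono[OF minus_le_neg_part[of x], of x] by simp

lemma neg_part_least: "0 \<le> z \<Longrightarrow> - x \<le> z \<Longrightarrow> neg_part (x::'a::banach_lattice) \<le> z"
  by (simp add: neg_part_def)

lemma norm_mono_nonneg: "0 \<le> x \<Longrightarrow> x \<le> y \<Longrightarrow> norm (x::'a::banach_lattice) \<le> norm y"
  by (rule norm_mono_abs) (simp add: order_trans[of 0 x y])

lemma norm_abs: "norm \<bar>x::'a::banach_lattice\<bar> = norm x"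
  by (intro order_antisym norm_mono_abs) simp_all

text \<open>
  The triangle inequality for negative parts. It says that \<open>x - y\<close> having a small negative part, that
  is, \<open>x\<close> being almost above \<open>y\<close>, is stable under small perturbations of \<open>y\<close>.
\<close>
lemma norm_neg_part_diff_le:
  fixes x y z :: "'a::banach_lattice"
  shows "norm (neg_part (x - z)) \<le> norm (neg_part (x - y)) + norm (y - z)"
proof -
  have "- (x - z) = - (x - y) + - (y - z)" by simp
  also have "\<dots> \<le> neg_part (x - y) + \<bar>y - z\<bar>"
    by (intro add_mono minus_le_neg_part abs_ge_minus_self)
  finally have "neg_part (x - z) \<le> neg_part (x - y) + \<bar>y - z\<bar>"
    by (intro neg_part_least add_nonneg_nonneg neg_part_nonneg abs_ge_zero)
  then have "norm (neg_part (x - z)) \<le> norm (neg_part (x - y) + \<bar>y - z\<bar>)"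
    by (intro norm_mono_nonneg neg_part_nonneg)
  also have "\<dots> \<le> norm (neg_part (x - y)) + norm (y - z)"
    using norm_triangle_ineq[of "neg_part (x - y)" "\<bar>y - z\<bar>"] by (simp add: norm_abs)
  finally show ?thesis .
qed

lemma norm_neg_part_le: "norm (neg_part x) \<le> norm (x::'a::banach_lattice)"
proof -
  have "neg_part x \<le> \<bar>x\<bar>"
    by (intro neg_part_least abs_ge_zero abs_ge_minus_self)
  then show ?thesis
    using norm_mono_nonneg[OF neg_part_nonneg, of x "\<bar>x\<bar>"] by (simp add: norm_abs)
qed

lemma norm_neg_part_sup_le:
  fixes x h k :: "'a::banach_lattice"
  shows "norm (neg_part (x - sup h k)) \<le> norm (neg_part (x - h)) + norm (neg_part (x - k))"
proof -
  have "h - x \<le> neg_part (x - h)" "k - x \<le> neg_part (x - k)"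
    using minus_le_neg_part[of "x - h"] minus_le_neg_part[of "x - k"] by simp_all
  then have "h - x \<le> neg_part (x - h) + neg_part (x - k)"
    and "k - x \<le> neg_part (x - h) + neg_part (x - k)"
    using neg_part_nonneg[of "x - h"] neg_part_nonneg[of "x - k"]
    by (auto intro: add_increasing add_increasing2)
  then have "sup h k \<le> neg_part (x - h) + neg_part (x - k) + x"
    by (simp add: diff_le_eq)
  then have "neg_part (x - sup h k) \<le> neg_part (x - h) + neg_part (x - k)"
    by (intro neg_part_least add_nonneg_nonneg neg_part_nonneg) (simp add: diff_le_eq)
  then have "norm (neg_part (x - sup h k)) \<le> norm (neg_part (x - h) + neg_part (x - k))"
    by (intro norm_mono_nonneg neg_part_nonneg)
  then show ?thesis
    using norm_triangle_ineq[of "neg_part (x - h)" "neg_part (x - k)"] by linarith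
qed

text \<open>
  A limit \<open>x\<close> of vectors \<open>y \<ge> 0\<close> satisfies \<open>x\<^sup>- \<le> \<bar>y - x\<bar>\<close>, so its negative part has norm zero.
\<close>
lemma closed_positive_cone: "closed {x::'a::banach_lattice. 0 \<le> x}"
  unfolding closed_sequential_limits
proof (intro allI impI, elim conjE)
  fix X and x :: 'a
  assume X: "\<forall>n. X n \<in> {x. 0 \<le> x}" and lim: "X \<longlonglongrightarrow> x"
  have le: "norm (neg_part x) \<le> norm (X n - x)" for n
  proof -
    have "neg_part (X n) = 0"
      using X by (simp add: neg_part_def sup_absorb2)
    then show ?thesis
      using norm_neg_part_diff_le[of 0 "- x" "- X n"] by (simp add: norm_minus_commute)
  qed
  have "(\<lambda>n. norm (X n - x)) \<longlonglongrightarrow> 0"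
    using tendsto_norm_zero[OF LIM_zero[OF lim]] .
  then have "norm (neg_part x) \<le> 0"
    by (rule LIMSEQ_le_const) (use le in auto)
  then show "x \<in> {x. 0 \<le> x}"
    using add_neg_part_nonneg[of x] by simp
qed

lemma tendsto_nonneg_vector:
  fixes F :: "'i \<Rightarrow> 'a::banach_lattice"
  assumes "(F \<longlongrightarrow> x) \<F>" "\<F> \<noteq> bot" "eventually (\<lambda>i. 0 \<le> F i) \<F>"
  shows "0 \<le> x"
  using Lim_in_closed_set[OF closed_positive_cone _ assms(2,1)] assms(3) by simp

section \<open>Monotone convergence in AL-spaces\<close>

lemma norm_diff_of_le:
  fixes x y :: "'a::al_space"
  assumes "0 \<le> x" "x \<le> y"
  shows "norm (y - x) = norm y - norm x"
  using norm_add_nonneg[of x "y - x"] assms by simp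

text \<open>
  A net is Cauchy as soon as, for every \<open>e\<close>, it stays within \<open>e\<close> of some point, which may depend on
  \<open>e\<close> and need not belong to the net. This form suits orbits that stay close to fixed vectors.
\<close>
lemma tendsto_if_eventually_near:
  fixes F :: "'i \<Rightarrow> 'a::complete_space"
  assumes "\<F> \<noteq> bot"
    and near: "\<And>e. e > 0 \<Longrightarrow> \<exists>a. eventually (\<lambda>i. dist (F i) a < e) \<F>"
  obtains l where "(F \<longlongrightarrow> l) \<F>"
proof -
  have "cauchy_filter (filtermap F \<F>)"
    unfolding cauchy_filter_metric_filtermap
  proof (intro allI impI)
    fix e :: real
    assume "e > 0"
    then obtain a where "eventually (\<lambda>i. dist (F i) a < e / 2) \<F>"
      using near[of "e / 2"] by auto
    then show "\<exists>P. eventually P \<F> \<and> (\<forall>i j. P i \<and> P j \<longrightarrow> dist (F i) (F j) < e)"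
      by (intro exI[of _ "\<lambda>i. dist (F i) a < e / 2"]) (auto intro: dist_triangle_half_l)
  qed
  then obtain l where "filtermap F \<F> \<le> nhds l"
    using cauchy_filter_complete_converges[of "filtermap F \<F>" UNIV] assms(1)
    by (auto simp: filtermap_bot_iff complete_UNIV)
  then show ?thesis
    using that by (simp add: filterlim_def)
qed

text \<open>
  Additivity of the norm turns monotone convergence of the norms into norm convergence of the
  vectors.
\<close>
lemma decreasing_family_converges:
  fixes F :: "real \<Rightarrow> 'a::al_space"
  assumes J: "at_top_in J \<noteq> bot"
    and nonneg: "\<And>t. t \<in> J \<Longrightarrow> 0 \<le> F t"
    and decreasing: "\<And>s t. s \<in> J \<Longrightarrow> t \<in> J \<Longrightarrow> s \<le> t \<Longrightarrow> F t \<le> F s"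
  obtains k where "(F \<longlongrightarrow> k) (at_top_in J)"
proof (rule tendsto_if_eventually_near[OF J])
  fix e :: real
  assume "e > 0"
  let ?N = "(\<lambda>t. norm (F t)) ` J"
  have "?N \<noteq> {}" "bdd_below ?N"
    using J by (auto simp: at_top_in_def intro!: bdd_belowI[of _ 0])
  then obtain t0 where t0: "t0 \<in> J" "norm (F t0) < Inf ?N + e"
    using \<open>e > 0\<close> cInf_less_iff[of ?N "Inf ?N + e"] by auto
  have "dist (F t) (F t0) < e" if "t \<in> J" "t0 \<le> t" for t
  proof -
    have "dist (F t) (F t0) = norm (F t0) - norm (F t)"
      using norm_diff_of_le[OF nonneg[OF that(1)] decreasing[OF t0(1) that]]
      by (simp add: dist_norm norm_minus_commute)
    then show ?thesis
      using cInf_lower[OF _ \<open>bdd_below ?N\<close>, of "norm (F t)"] that t0 by force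
  qed
  then show "\<exists>a. eventually (\<lambda>t. dist (F t) a < e) (at_top_in J)"
    unfolding eventually_at_top_in by blast
qed

text \<open>
  A maximising sequence for the norm can be made increasing by taking suprema; it is then a Cauchy
  sequence, and its limit \<open>b\<close> has maximal norm. If \<open>x\<close> is another element, \<open>sup x b - b\<close> must have
  norm zero, because the norm is additive and \<open>sup x b\<close> is not longer than \<open>b\<close>.
\<close>
lemma bounded_sup_closed_set_has_greatest:
  fixes S :: "'a::al_space set"
  assumes "S \<noteq> {}" and "closed S" and sup_S: "\<And>x y. x \<in> S \<Longrightarrow> y \<in> S \<Longrightarrow> sup x y \<in> S"
    and nonneg: "\<And>x. x \<in> S \<Longrightarrow> 0 \<le> x" and bounded: "\<And>x. x \<in> S \<Longrightarrow> norm x \<le> B"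
  obtains b where "b \<in> S" "\<And>x. x \<in> S \<Longrightarrow> x \<le> b"
proof -
  define \<sigma> where "\<sigma> = Sup (norm ` S)"
  have le_\<sigma>: "norm x \<le> \<sigma>" if "x \<in> S" for x
    unfolding \<sigma>_def using that bounded by (intro cSup_upper) (auto intro: bdd_aboveI[of _ B])
  have "\<exists>x\<in>S. \<sigma> - inverse (real (Suc n)) < norm x" for n
    using less_cSupD[of "norm ` S" "\<sigma> - inverse (real (Suc n))"] \<open>S \<noteq> {}\<close>
    unfolding \<sigma>_def by auto
  then obtain a where a: "\<And>n. a n \<in> S" "\<And>n. \<sigma> - inverse (real (Suc n)) < norm (a n)"
    by metis
  define b where "b = rec_nat (a 0) (\<lambda>n x. sup x (a (Suc n)))"
  have b_Suc: "b (Suc n) = sup (b n) (a (Suc n))" for n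
    by (simp add: b_def)
  have b_S: "b n \<in> S" for n
    by (induction n) (simp_all add: b_Suc a sup_S, simp add: b_def a)
  have "a n \<le> b n" for n
    by (cases n) (simp_all add: b_Suc, simp add: b_def)
  then have b_large: "\<sigma> - inverse (real (Suc n)) < norm (b n)" for n
    using norm_mono_nonneg[OF nonneg[OF a(1)], of n "b n"] a(2)[of n] by simp
  have b_mono: "m \<le> n \<Longrightarrow> b m \<le> b n" for m n
    by (rule lift_Suc_mono_le) (simp_all add: b_Suc)
  obtain c where lim: "b \<longlonglongrightarrow> c"
  proof (rule tendsto_if_eventually_near[of sequentially b])
    fix e :: real
    assume "e > 0"
    then obtain m where m: "inverse (real (Suc m)) < e"
      using reals_Archimedean by blast
    have "dist (b n) (b m) < e" if "m \<le> n" for n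
      using norm_diff_of_le[OF nonneg[OF b_S] b_mono[OF that]] le_\<sigma>[OF b_S, of n] b_large[of m] m
      by (simp add: dist_norm)
    then show "\<exists>a. eventually (\<lambda>n. dist (b n) a < e) sequentially"
      unfolding eventually_sequentially by blast
  qed auto
  have c: "c \<in> S"
    using closed_sequentially[OF \<open>closed S\<close> _ lim] b_S by blast
  have norm_c: "\<sigma> \<le> norm c"
  proof (rule LIMSEQ_le[OF _ tendsto_norm[OF lim]])
    show "(\<lambda>n. \<sigma> - inverse (real (Suc n))) \<longlonglongrightarrow> \<sigma>"
      using tendsto_diff[OF tendsto_const LIMSEQ_inverse_real_of_nat] by simp
  qed (use b_large less_imp_le in blast)
  have "x \<le> c" if "x \<in> S" for x
  proof -
    have "norm (sup x c - c) \<le> 0"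
      using norm_diff_of_le[OF nonneg[OF c], of "sup x c"] le_\<sigma>[OF sup_S[OF that c]] norm_c by simp
    then show ?thesis
      using sup_ge1[of x c] by simp
  qed
  with c show ?thesis
    using that by blast
qed

section \<open>Lower bounds for bounded positive semigroups\<close>

text \<open>
  Requiring \<open>M \<ge> 1\<close> allows division by \<open>M\<close> and makes \<open>e / M \<le> e\<close> for error bounds \<open>e\<close>.
\<close>
locale bounded_positive_semigroup =
  fixes J :: "real set" and T :: "real \<Rightarrow> 'a::al_space \<Rightarrow>\<^sub>L 'a" and M :: real
  assumes time: "J = discrete_time \<or> J = continuous_time"
    and semigroup: "\<And>s t x. s \<in> J \<Longrightarrow> t \<in> J \<Longrightarrow> T (t + s) x = T t (T s x)"
    and norm_le: "\<And>t x. t \<in> J \<Longrightarrow> norm (T t x) \<le> M * norm x"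
    and M_ge_1: "M \<ge> 1"
    and positive: "\<And>t x. t \<in> J \<Longrightarrow> 0 \<le> x \<Longrightarrow> 0 \<le> T t x"
begin

lemma nontrivial: "at_top_in J \<noteq> bot"
  using time at_top_in_nontrivial by auto

lemma time_nonempty: "\<exists>t. t \<in> J"
  using time by (auto simp: discrete_time_def continuous_time_def intro!: exI[of _ 1])

lemma time_add: "s \<in> J \<Longrightarrow> t \<in> J \<Longrightarrow> t + s \<in> J"
  using time
proof (elim disjE)
  assume J: "J = discrete_time" and "s \<in> J" "t \<in> J"
  then obtain m n where "s = real m" "t = real n" "m \<ge> 1" "n \<ge> 1"
    by (auto simp: discrete_time_def)
  then show ?thesis
    unfolding J discrete_time_def by (intro image_eqI[of _ _ "n + m"]) auto
qed (simp add: continuous_time_def)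

lemma time_diff: "s \<in> J \<Longrightarrow> t \<in> J \<Longrightarrow> s < t \<Longrightarrow> t - s \<in> J"
  using time
proof (elim disjE)
  assume J: "J = discrete_time" and "s \<in> J" "t \<in> J" "s < t"
  then obtain m n where "s = real m" "t = real n" "m < n"
    by (auto simp: discrete_time_def)
  then show ?thesis
    unfolding J discrete_time_def by (intro image_eqI[of _ _ "n - m"]) auto
qed (simp add: continuous_time_def)

lemma filterlim_time_shift: "s \<in> J \<Longrightarrow> filterlim (\<lambda>t. t + s) (at_top_in J) (at_top_in J)"
  unfolding filterlim_iff eventually_at_top_in
proof (intro allI impI, elim exE)
  fix P t0
  assume "s \<in> J" "\<forall>t\<in>J. t0 \<le> t \<longrightarrow> P t"
  then show "\<exists>t0. \<forall>t\<in>J. t0 \<le> t \<longrightarrow> P (t + s)"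
    using time_add by (intro exI[of _ "t0 - s"]) (auto simp: algebra_simps)
qed

lemma eventually_time_shift:
  assumes "s \<in> J" "eventually (\<lambda>t. P (t + s)) (at_top_in J)"
  shows "eventually P (at_top_in J)"
proof -
  obtain t0 where t0: "\<And>t. t \<in> J \<Longrightarrow> t0 \<le> t \<Longrightarrow> P (t + s)"
    using assms(2) unfolding eventually_at_top_in by blast
  have "P t" if "t \<in> J" "max (s + 1) (t0 + s) \<le> t" for t
    using t0[of "t - s"] time_diff[OF assms(1) that(1)] that(2) by simp
  then show ?thesis
    unfolding eventually_at_top_in by blast
qed

lemma eventually_timeI: "(\<And>t. t \<in> J \<Longrightarrow> P t) \<Longrightarrow> eventually P (at_top_in J)"
  unfolding eventually_at_top_in by blast

lemma eventually_time: "eventually (\<lambda>t. t \<in> J) (at_top_in J)"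
  unfolding eventually_at_top_in by blast

lemma mono: "t \<in> J \<Longrightarrow> x \<le> y \<Longrightarrow> T t x \<le> T t y"
  using positive[of t "y - x"] by (simp add: blinfun.diff_right)

abbreviation lower_bounds :: "'a \<Rightarrow> 'a set" where
  "lower_bounds f \<equiv> {h. is_lower_bound J T f h}"

lemma lower_bound_eventually:
  "is_lower_bound J T f h \<longleftrightarrow>
     0 \<le> h \<and> (\<forall>e>0. eventually (\<lambda>t. norm (neg_part (T t f - h)) < e) (at_top_in J))"
  by (simp add: is_lower_bound_def tendsto_iff)

lemma lower_boundD:
  assumes "is_lower_bound J T f h"
  shows "0 \<le> h" "e > 0 \<Longrightarrow> eventually (\<lambda>t. norm (neg_part (T t f - h)) < e) (at_top_in J)"
  using assms unfolding lower_bound_eventually by blast+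

text \<open>
  The vectors \<open>(T t f - h)\<^sup>+\<close> lie in the closed positive cone and converge to \<open>x - h\<close>.
\<close>
lemma lower_bound_le_limit:
  assumes h: "is_lower_bound J T f h" and lim: "((\<lambda>t. T t f) \<longlongrightarrow> x) (at_top_in J)"
  shows "h \<le> x"
proof -
  have neg: "((\<lambda>t. neg_part (T t f - h)) \<longlongrightarrow> 0) (at_top_in J)"
    using h unfolding is_lower_bound_def by (simp add: tendsto_norm_zero_iff)
  have "((\<lambda>t. T t f - h + neg_part (T t f - h)) \<longlongrightarrow> x - h + 0) (at_top_in J)"
    by (rule tendsto_add[OF tendsto_diff[OF lim tendsto_const] neg])
  then have "0 \<le> x - h + 0"
    using nontrivial by (rule tendsto_nonneg_vector) (simp add: add_neg_part_nonneg)
  then show ?thesis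
    by simp
qed

text \<open>
  \<open>h\<close> lies below \<open>T t f\<close> up to an error that tends to zero, so its norm cannot exceed the
  uniform bound on the orbit.
\<close>
lemma norm_lower_bound_le:
  assumes h: "is_lower_bound J T f h"
  shows "norm h \<le> M * norm f"
proof -
  have "((\<lambda>t. M * norm f + norm (neg_part (T t f - h))) \<longlongrightarrow> M * norm f + 0) (at_top_in J)"
    using h unfolding is_lower_bound_def by (intro tendsto_add tendsto_const) simp
  moreover have "norm h \<le> M * norm f + norm (neg_part (T t f - h))" if "t \<in> J" for t
  proof -
    have "h \<le> T t f + neg_part (T t f - h)"
      using add_neg_part_nonneg[of "T t f - h"] by (simp add: algebra_simps)
    then have "norm h \<le> norm (T t f + neg_part (T t f - h))"
      using h by (intro norm_mono_nonneg) (auto simp: is_lower_bound_def)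
    then show ?thesis
      using norm_triangle_ineq[of "T t f" "neg_part (T t f - h)"] norm_le[OF that, of f] by linarith
  qed
  then have "eventually (\<lambda>t. norm h \<le> M * norm f + norm (neg_part (T t f - h))) (at_top_in J)"
    by (rule eventually_timeI)
  ultimately have "norm h \<le> M * norm f + 0"
    using nontrivial by (rule tendsto_lowerbound)
  then show ?thesis
    by simp
qed

lemma lower_bound_sup:
  assumes "is_lower_bound J T f h" "is_lower_bound J T f k"
  shows "is_lower_bound J T f (sup h k)"
  unfolding is_lower_bound_def
proof
  show "0 \<le> sup h k"
    by (rule le_supI1) (use assms in \<open>simp add: is_lower_bound_def\<close>)
  have "((\<lambda>t. norm (neg_part (T t f - h)) + norm (neg_part (T t f - k))) \<longlongrightarrow> 0 + 0) (at_top_in J)"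
    using assms unfolding is_lower_bound_def by (intro tendsto_add) auto
  then have lim: "((\<lambda>t. norm (neg_part (T t f - h)) + norm (neg_part (T t f - k))) \<longlongrightarrow> 0) (at_top_in J)"
    by simp
  show "((\<lambda>t. norm (neg_part (T t f - sup h k))) \<longlongrightarrow> 0) (at_top_in J)"
    by (rule tendsto_sandwich[OF _ _ tendsto_const lim]; intro always_eventually allI
        norm_neg_part_sup_le norm_ge_zero)
qed

lemma closed_lower_bounds: "closed (lower_bounds f)"
proof -
  have "h \<in> lower_bounds f" if h: "\<And>e. e > 0 \<Longrightarrow> \<exists>k\<in>lower_bounds f. dist k h < e" for h
  proof -
    have "h \<in> closure {x. 0 \<le> x}"
      unfolding closure_approachable using h by (auto simp: is_lower_bound_def)
    then have "0 \<le> h"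
      by (simp add: closure_closed[OF closed_positive_cone])
    moreover have "eventually (\<lambda>t. norm (neg_part (T t f - h)) < e) (at_top_in J)" if "e > 0" for e
    proof -
      obtain k where k: "is_lower_bound J T f k" "dist k h < e / 2"
        using h[of "e / 2"] \<open>e > 0\<close> by auto
      have "eventually (\<lambda>t. norm (neg_part (T t f - k)) < e / 2) (at_top_in J)"
        using lower_boundD(2)[OF k(1), of "e / 2"] \<open>e > 0\<close> by simp
      then show ?thesis
      proof (rule eventually_mono)
        fix t
        assume "norm (neg_part (T t f - k)) < e / 2"
        then show "norm (neg_part (T t f - h)) < e"
          using norm_neg_part_diff_le[of "T t f" h k] k(2) by (simp add: dist_norm)
      qed
    qed
    ultimately show ?thesis
      by (simp add: lower_bound_eventually)
  qed
  then have "h \<in> lower_bounds f" if "h \<in> closure (lower_bounds f)" for h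
    using that unfolding closure_approachable by simp
  then have "closure (lower_bounds f) \<subseteq> lower_bounds f"
    by (rule subsetI)
  then show ?thesis
    by (simp add: closure_subset_eq)
qed

lemma norm_neg_part_orbit_le:
  assumes "t \<in> J"
  shows "norm (neg_part (T t x)) \<le> M * norm (neg_part x)"
proof -
  have "- T t x \<le> T t (neg_part x)"
    using mono[OF assms minus_le_neg_part[of x]] by (simp add: blinfun.minus_right)
  then have "neg_part (T t x) \<le> T t (neg_part x)"
    by (intro neg_part_least positive neg_part_nonneg assms)
  then show ?thesis
    using norm_mono_nonneg[OF neg_part_nonneg, of "T t x"] norm_le[OF assms, of "neg_part x"]
    by fastforce
qed

text \<open>
  Positivity gives \<open>(T s x)\<^sup>- \<le> T s (x\<^sup>-)\<close>; with \<open>x = T t f - h\<close> the time-\<open>s\<close> image of the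
  asymptotic inequality for \<open>h\<close> is the one for \<open>T s h\<close>, seen from time \<open>t + s\<close> on.
\<close>
lemma lower_bound_orbit:
  assumes h: "is_lower_bound J T f h" and s: "s \<in> J"
  shows "is_lower_bound J T f (T s h)"
  unfolding lower_bound_eventually
proof (intro conjI allI impI)
  show "0 \<le> T s h"
    using h s positive by (auto simp: is_lower_bound_def)
  fix e :: real
  assume "e > 0"
  then have "eventually (\<lambda>t. norm (neg_part (T t f - h)) < e / M) (at_top_in J)"
    using lower_boundD(2)[OF h, of "e / M"] M_ge_1 by simp
  then have "eventually (\<lambda>t. norm (neg_part (T (t + s) f - T s h)) < e) (at_top_in J)"
    using eventually_time
  proof eventually_elim
    case (elim t)
    have "T (t + s) f - T s h = T s (T t f - h)"
      using semigroup[OF elim(2) s] by (simp add: blinfun.diff_right add.commute)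
    then show ?case
      using norm_neg_part_orbit_le[OF s, of "T t f - h"] elim(1) M_ge_1
      by (simp add: pos_less_divide_eq mult.commute)
  qed
  then show "eventually (\<lambda>t. norm (neg_part (T t f - T s h)) < e) (at_top_in J)"
    by (rule eventually_time_shift[OF s])
qed

section \<open>Lower bounds that are fixed by the semigroup\<close>

lemma greatest_lower_bound:
  assumes "0 \<le> f"
  obtains h where "is_lower_bound J T f h" "\<And>k. is_lower_bound J T f k \<Longrightarrow> k \<le> h"
proof (rule bounded_sup_closed_set_has_greatest[of "lower_bounds f" "M * norm f"])
  have "neg_part (T t f - 0) = 0" if "t \<in> J" for t
    using positive[OF that assms] by (simp add: neg_part_def sup_absorb2)
  then have "is_lower_bound J T f 0"
    unfolding lower_bound_eventually by (intro conjI allI impI eventually_timeI) auto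
  then show "lower_bounds f \<noteq> {}"
    by blast
  show "closed (lower_bounds f)"
    by (rule closed_lower_bounds)
qed (use that in \<open>auto intro: lower_bound_sup norm_lower_bound_le lower_boundD(1)\<close>)

text \<open>
  The greatest lower bound \<open>h\<close> of \<open>f\<close> dominates its own orbit, which therefore decreases to a fixed
  vector \<open>k\<close>. One factor \<open>\<epsilon>\<close> is spent on \<open>h\<close> being large compared with \<open>f\<close>, the other on \<open>k\<close> being
  large compared with \<open>h\<close>.
\<close>
lemma fixed_lower_bound:
  assumes "\<epsilon> > 0"
    and large: "\<And>f. 0 \<le> f \<Longrightarrow> \<exists>h. is_lower_bound J T f h \<and> \<epsilon> * norm f \<le> norm h"
    and "0 \<le> f"
  obtains k where "is_lower_bound J T f k" "\<And>s. s \<in> J \<Longrightarrow> T s k = k" "\<epsilon>\<^sup>2 * norm f \<le> norm k"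
proof -
  obtain h where h: "is_lower_bound J T f h" and greatest: "\<And>k. is_lower_bound J T f k \<Longrightarrow> k \<le> h"
    using greatest_lower_bound[OF \<open>0 \<le> f\<close>] by blast
  have "0 \<le> h"
    using h by (simp add: is_lower_bound_def)
  have super: "T s h \<le> h" if "s \<in> J" for s
    using greatest lower_bound_orbit[OF h that] by blast
  obtain k where lim: "((\<lambda>t. T t h) \<longlongrightarrow> k) (at_top_in J)"
  proof (rule decreasing_family_converges[OF nontrivial])
    fix s t
    assume st: "s \<in> J" "t \<in> J" "s \<le> t"
    show "T t h \<le> T s h"
    proof (cases "s = t")
      case False
      then have "t - s \<in> J"
        using st by (intro time_diff) auto
      then show ?thesis
        using semigroup[of "t - s" s h] mono[OF st(1) super[of "t - s"]] st(1) by simp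
    qed simp
  qed (use positive \<open>0 \<le> h\<close> in auto)
  have "k \<in> lower_bounds f"
    using lower_bound_orbit[OF h]
    by (intro Lim_in_closed_set[OF closed_lower_bounds _ nontrivial lim] eventually_timeI) simp
  moreover have "T s k = k" if "s \<in> J" for s
  proof (rule tendsto_unique[OF nontrivial])
    have "((\<lambda>t. T s (T t h)) \<longlongrightarrow> T s k) (at_top_in J)"
      by (rule blinfun.tendsto[OF tendsto_const lim])
    moreover have "eventually (\<lambda>t. T s (T t h) = T (t + s) h) (at_top_in J)"
      using eventually_time
    proof eventually_elim
      case (elim t)
      then show ?case
        using semigroup[OF elim that] by (simp add: add.commute)
    qed
    ultimately show "((\<lambda>t. T (t + s) h) \<longlongrightarrow> T s k) (at_top_in J)"
      using tendsto_cong by force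
    show "((\<lambda>t. T (t + s) h) \<longlongrightarrow> k) (at_top_in J)"
      by (rule filterlim_compose[OF lim filterlim_time_shift[OF that]])
  qed
  moreover have "\<epsilon>\<^sup>2 * norm f \<le> norm k"
  proof -
    obtain h' where h': "is_lower_bound J T f h'" "\<epsilon> * norm f \<le> norm h'"
      using large[OF \<open>0 \<le> f\<close>] by blast
    then have "\<epsilon> * norm f \<le> norm h"
      using norm_mono_nonneg[of h' h] greatest[of h'] by (simp add: is_lower_bound_def)
    then have "\<epsilon>\<^sup>2 * norm f \<le> \<epsilon> * norm h"
      using \<open>\<epsilon> > 0\<close> by (simp add: power2_eq_square mult.assoc)
    moreover obtain k' where k': "is_lower_bound J T h k'" "\<epsilon> * norm h \<le> norm k'"
      using large[OF \<open>0 \<le> h\<close>] by blast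
    moreover have "norm k' \<le> norm k"
      using k'(1) lower_bound_le_limit[OF k'(1) lim]
      by (intro norm_mono_nonneg) (auto simp: is_lower_bound_def)
    ultimately show ?thesis
      by linarith
  qed
  ultimately show ?thesis
    using that by simp
qed

section \<open>Convergence of the orbits\<close>

text \<open>
  As long as the remainder \<open>g\<close> is longer than \<open>\<eta>\<close>, it has a fixed lower bound \<open>k\<close> of norm at least
  \<open>\<delta> * \<eta>\<close>. Moving \<open>k\<close> from the remainder to the fixed part increases the norm of the fixed part
  by the norm of \<open>k\<close>, and \<open>n\<close> counts these moves. The error is quantified inside the induction because
  each move multiplies the previous error by \<open>M\<close>.
\<close>
lemma orbit_near_fixed_plus_remainder:
  assumes fixed: "\<forall>g\<ge>0. \<exists>k. is_lower_bound J T g k \<and> (\<forall>s\<in>J. T s k = k) \<and> \<delta> * norm g \<le> norm k"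
    and "\<delta> > 0" "\<eta> > 0" "0 \<le> f" "e > 0"
  shows "\<exists>t\<in>J. \<exists>u g. 0 \<le> u \<and> (\<forall>s\<in>J. T s u = u) \<and> 0 \<le> g \<and> norm (T t f - (u + g)) \<le> e \<and>
    (norm g \<le> \<eta> \<or> real n * (\<delta> * \<eta>) \<le> norm u)"
  using \<open>e > 0\<close>
proof (induction n arbitrary: e)
  case 0
  obtain t where "t \<in> J"
    using time_nonempty by blast
  then show ?case
    using 0 positive[OF _ \<open>0 \<le> f\<close>, of t]
    by (intro bexI[of _ t] exI[of _ 0] exI[of _ "T t f"]) auto
next
  case (Suc n)
  have "e / (2 * M) > 0" "e / (2 * M) \<le> e / 2"
    using Suc.prems M_ge_1 by (auto simp: field_simps)
  then obtain t u g where t: "t \<in> J" and u: "0 \<le> u" "\<And>s. s \<in> J \<Longrightarrow> T s u = u" and g: "0 \<le> g"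
    and near: "norm (T t f - (u + g)) \<le> e / (2 * M)"
    and dich: "norm g \<le> \<eta> \<or> real n * (\<delta> * \<eta>) \<le> norm u"
    using Suc.IH[of "e / (2 * M)"] by blast
  show ?case
  proof (cases "norm g \<le> \<eta>")
    case True
    then show ?thesis
      using t u g near \<open>e / (2 * M) \<le> e / 2\<close> Suc.prems
      by (intro bexI[of _ t] exI[of _ u] exI[of _ g]) auto
  next
    case False
    obtain k where k: "is_lower_bound J T g k" "\<And>s. s \<in> J \<Longrightarrow> T s k = k" "\<delta> * norm g \<le> norm k"
      using fixed g by blast
    have "0 \<le> k"
      using k(1) by (simp add: is_lower_bound_def)
    have "eventually (\<lambda>s. s \<in> J \<and> norm (neg_part (T s g - k)) < e / 2) (at_top_in J)"
      using lower_boundD(2)[OF k(1), of "e / 2"] Suc.prems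
      by (intro eventually_conj eventually_time) simp
    then obtain s where s: "s \<in> J" "norm (neg_part (T s g - k)) < e / 2"
      using eventually_happens'[OF nontrivial] by blast
    \<comment> \<open>the positive part of \<open>T s g - k\<close>, so that \<open>T s g\<close> is \<open>k + g'\<close> minus a small vector\<close>
    define g' where "g' = T s g - k + neg_part (T s g - k)"
    have "T (s + t) f - (u + k + g') = T s (T t f - (u + g)) - neg_part (T s g - k)"
      using semigroup[OF t s(1)] u(2)[OF s(1)]
      by (simp add: g'_def blinfun.diff_right blinfun.add_right algebra_simps)
    moreover have "norm (T s (T t f - (u + g))) \<le> e / 2"
      using norm_le[OF s(1), of "T t f - (u + g)"] near M_ge_1 by (simp add: field_simps)
    ultimately have "norm (T (s + t) f - (u + k + g')) \<le> e"
      using s(2) norm_triangle_ineq4[of "T s (T t f - (u + g))" "neg_part (T s g - k)"] by simp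
    moreover have "real (Suc n) * (\<delta> * \<eta>) \<le> norm (u + k)"
    proof -
      have "\<delta> * \<eta> \<le> \<delta> * norm g"
        using False \<open>\<delta> > 0\<close> by simp
      then show ?thesis
        using dich False k(3) by (simp add: norm_add_nonneg[OF u(1) \<open>0 \<le> k\<close>] distrib_right)
    qed
    ultimately show ?thesis
      using u k(2) \<open>0 \<le> k\<close> time_add[OF t s(1)] add_neg_part_nonneg[of "T s g - k"]
      by (intro bexI[of _ "s + t"] exI[of _ "u + k"] exI[of _ g'])
        (auto simp: g'_def blinfun.add_right)
  qed
qed

text \<open>
  The fixed part \<open>u\<close> is bounded by the norm of \<open>u + g\<close>, hence essentially by \<open>M * norm f\<close>. After
  sufficiently many moves only the alternative of a short remainder is left.
\<close>
lemma orbit_near_fixed_vector: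
  assumes fixed: "\<forall>g\<ge>0. \<exists>k. is_lower_bound J T g k \<and> (\<forall>s\<in>J. T s k = k) \<and> \<delta> * norm g \<le> norm k"
    and "\<delta> > 0" "0 \<le> f" "e > 0"
  shows "\<exists>t\<in>J. \<exists>u. (\<forall>s\<in>J. T s u = u) \<and> norm (T t f - u) \<le> e"
proof -
  define \<eta> where "\<eta> = e / 2"
  have "\<eta> > 0"
    using \<open>e > 0\<close> by (simp add: \<eta>_def)
  \<comment> \<open>more moves than the available norm permits\<close>
  obtain n where n: "M * norm f + \<eta> < real n * (\<delta> * \<eta>)"
    using reals_Archimedean3[of "\<delta> * \<eta>"] \<open>\<delta> > 0\<close> \<open>\<eta> > 0\<close> by auto
  obtain t u g where t: "t \<in> J" and u: "0 \<le> u" "\<And>s. s \<in> J \<Longrightarrow> T s u = u" and g: "0 \<le> g"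
    and near: "norm (T t f - (u + g)) \<le> \<eta>"
    and dich: "norm g \<le> \<eta> \<or> real n * (\<delta> * \<eta>) \<le> norm u"
    using orbit_near_fixed_plus_remainder[OF fixed \<open>\<delta> > 0\<close> \<open>\<eta> > 0\<close> \<open>0 \<le> f\<close> \<open>\<eta> > 0\<close>, of n]
    by blast
  have "norm u \<le> norm (u + g)"
    using u(1) g by (simp add: norm_add_nonneg)
  also have "\<dots> \<le> M * norm f + \<eta>"
    using norm_triangle_sub[of "u + g" "T t f"] near norm_le[OF t, of f]
    by (simp add: norm_minus_commute)
  finally have "norm g \<le> \<eta>"
    using dich n by linarith
  then have "norm (T t f - u) \<le> e"
    using near norm_triangle_ineq[of "T t f - (u + g)" g] by (simp add: \<eta>_def)
  then show ?thesis
    using t u(2) by (intro bexI[of _ t] exI[of _ u]) simp_all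
qed

text \<open>
  Once \<open>T t f\<close> is within \<open>e / (2 * M)\<close> of a fixed vector \<open>u\<close>, all later \<open>T (s + t) f\<close> are within
  \<open>e / 2\<close> of \<open>T s u = u\<close>.
\<close>
lemma orbit_converges:
  assumes fixed: "\<forall>g\<ge>0. \<exists>k. is_lower_bound J T g k \<and> (\<forall>s\<in>J. T s k = k) \<and> \<delta> * norm g \<le> norm k"
    and "\<delta> > 0" "0 \<le> f"
  obtains l where "((\<lambda>t. T t f) \<longlongrightarrow> l) (at_top_in J)"
proof (rule tendsto_if_eventually_near[OF nontrivial])
  fix e :: real
  assume "e > 0"
  then have "e / (2 * M) > 0"
    using M_ge_1 by simp
  then obtain t u where t: "t \<in> J" and fixed_u: "\<forall>s\<in>J. T s u = u"
    and near: "norm (T t f - u) \<le> e / (2 * M)"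
    using orbit_near_fixed_vector[OF fixed \<open>\<delta> > 0\<close> \<open>0 \<le> f\<close>] by meson
  have "dist (T (s + t) f) u < e" if "s \<in> J" for s
  proof -
    have "T (s + t) f - u = T s (T t f - u)"
      using semigroup[OF t that] fixed_u that by (simp add: blinfun.diff_right)
    moreover have "M * norm (T t f - u) \<le> e / 2"
      using near M_ge_1 by (simp add: field_simps)
    ultimately show ?thesis
      using norm_le[OF that, of "T t f - u"] \<open>e > 0\<close> by (simp add: dist_norm)
  qed
  then have "eventually (\<lambda>s. dist (T s f) u < e) (at_top_in J)"
    by (rule eventually_time_shift[OF t eventually_timeI])
  then show "\<exists>a. eventually (\<lambda>s. dist (T s f) a < e) (at_top_in J)"
    by blast
qed

text \<open>
  Every vector is a difference of positive ones, and the pointwise limit inherits linearity and the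
  bound \<open>M\<close>.
\<close>
lemma strongly_convergent:
  assumes pos_conv: "\<And>f. 0 \<le> f \<Longrightarrow> \<exists>l. ((\<lambda>t. T t f) \<longlongrightarrow> l) (at_top_in J)"
  obtains P where "converges_strongly_to J T P"
proof -
  have "\<exists>l. ((\<lambda>t. T t f) \<longlongrightarrow> l) (at_top_in J)" for f
  proof -
    obtain l1 l2 where "((\<lambda>t. T t (f + neg_part f)) \<longlongrightarrow> l1) (at_top_in J)"
      and "((\<lambda>t. T t (neg_part f)) \<longlongrightarrow> l2) (at_top_in J)"
      using pos_conv add_neg_part_nonneg neg_part_nonneg by meson
    then have "((\<lambda>t. T t (f + neg_part f) - T t (neg_part f)) \<longlongrightarrow> l1 - l2) (at_top_in J)"
      by (rule tendsto_diff)
    then show ?thesis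
      by (auto simp: blinfun.add_right)
  qed
  then obtain L where L: "\<And>f. ((\<lambda>t. T t f) \<longlongrightarrow> L f) (at_top_in J)"
    by metis
  have "bounded_linear L"
  proof (rule bounded_linear_intro)
    show "L (x + y) = L x + L y" for x y
      using tendsto_unique[OF nontrivial L[of "x + y"]] tendsto_add[OF L[of x] L[of y]]
      by (simp add: blinfun.add_right)
    show "L (r *\<^sub>R x) = r *\<^sub>R L x" for r x
      using tendsto_unique[OF nontrivial L[of "r *\<^sub>R x"]] tendsto_scaleR[OF tendsto_const L[of x]]
      by (simp add: blinfun.scaleR_right)
    show "norm (L x) \<le> norm x * M" for x
      using norm_le[of _ x]
      by (intro tendsto_upperbound[OF tendsto_norm[OF L[of x]] _ nontrivial] eventually_timeI)
        (simp add: mult.commute)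
  qed
  then have "converges_strongly_to J T (Blinfun L)"
    unfolding converges_strongly_to_iff using L by (simp add: bounded_linear_Blinfun_apply)
  then show ?thesis
    using that by blast
qed

section \<open>The equivalence\<close>

text \<open>
  Lower bounds scale with the vector, so a bound for normalised vectors is one for all vectors.
\<close>
lemma lower_bound_of_normalised:
  assumes norm1: "\<And>f. 0 \<le> f \<Longrightarrow> norm f = 1 \<Longrightarrow> \<exists>h. is_lower_bound J T f h \<and> \<epsilon> \<le> norm h"
    and "0 \<le> f"
  shows "\<exists>h. is_lower_bound J T f h \<and> \<epsilon> * norm f \<le> norm h"
proof (cases "f = 0")
  case True
  obtain h where "is_lower_bound J T 0 h"
    using greatest_lower_bound[of 0] by auto
  then show ?thesis
    using True by auto
next
  case False
  define c where "c = norm f"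
  have "c > 0"
    using False by (simp add: c_def)
  then have "0 \<le> f /\<^sub>R c" "norm (f /\<^sub>R c) = 1"
    using \<open>0 \<le> f\<close> by (simp_all add: c_def scaleR_nonneg_nonneg)
  then obtain h where h: "is_lower_bound J T (f /\<^sub>R c) h" "\<epsilon> \<le> norm h"
    using norm1 by blast
  have le: "norm (neg_part (T t f - c *\<^sub>R h)) \<le> c * norm (neg_part (T t (f /\<^sub>R c) - h))" for t
  proof -
    define x where "x = T t (f /\<^sub>R c) - h"
    have x: "T t f - c *\<^sub>R h = c *\<^sub>R x"
      using \<open>c > 0\<close> by (simp add: x_def blinfun.scaleR_right scaleR_diff_right)
    have "neg_part (c *\<^sub>R x) \<le> c *\<^sub>R neg_part x"
      using scaleR_left_mono[OF minus_le_neg_part[of x], of c] \<open>c > 0\<close>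
      by (intro neg_part_least scaleR_nonneg_nonneg neg_part_nonneg) auto
    then have "norm (neg_part (c *\<^sub>R x)) \<le> norm (c *\<^sub>R neg_part x)"
      by (intro norm_mono_nonneg neg_part_nonneg)
    then show ?thesis
      using \<open>c > 0\<close> unfolding x x_def[symmetric] by simp
  qed
  have "((\<lambda>t. c * norm (neg_part (T t (f /\<^sub>R c) - h))) \<longlongrightarrow> c * 0) (at_top_in J)"
    using h(1) unfolding is_lower_bound_def by (intro tendsto_mult tendsto_const) simp
  then have lim: "((\<lambda>t. c * norm (neg_part (T t (f /\<^sub>R c) - h))) \<longlongrightarrow> 0) (at_top_in J)"
    by simp
  have "((\<lambda>t. norm (neg_part (T t f - c *\<^sub>R h))) \<longlongrightarrow> 0) (at_top_in J)"
    by (rule tendsto_sandwich[OF _ _ tendsto_const lim]; intro always_eventually allI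
        le norm_ge_zero)
  then have "is_lower_bound J T f (c *\<^sub>R h)"
    using h(1) \<open>c > 0\<close> by (simp add: is_lower_bound_def scaleR_nonneg_nonneg)
  moreover have "\<epsilon> * norm f \<le> norm (c *\<^sub>R h)"
    using h(2) \<open>c > 0\<close> by (simp add: c_def mult.commute)
  ultimately show ?thesis
    by blast
qed

lemma limit_is_lower_bound:
  assumes "((\<lambda>t. T t f) \<longlongrightarrow> x) (at_top_in J)" "0 \<le> f"
  shows "is_lower_bound J T f x"
  unfolding is_lower_bound_def
proof
  show "0 \<le> x"
    using assms positive
    by (intro tendsto_nonneg_vector[OF assms(1) nontrivial] eventually_timeI) simp
  show "((\<lambda>t. norm (neg_part (T t f - x))) \<longlongrightarrow> 0) (at_top_in J)"
    using tendsto_norm_zero[OF LIM_zero[OF assms(1)]]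
    by (rule Lim_null_comparison[rotated]) (simp add: norm_neg_part_le)
qed

end

theorem corollary4p5:
  fixes T :: "real \<Rightarrow> 'a::al_space \<Rightarrow>\<^sub>L 'a" and J :: "real set" and \<epsilon> :: real
  assumes "J = discrete_time \<or> J = continuous_time"
    and "bounded_semigroup J T" and "positive_semigroup J T"
    and "\<epsilon> > 0"
  shows "(\<exists>P. converges_strongly_to J T P \<and>
            (\<forall>f\<ge>0. norm (blinfun_apply P f) \<ge> \<epsilon> * norm f)) \<longleftrightarrow>
         (\<forall>f\<ge>0. norm f = 1 \<longrightarrow> (\<exists>h. is_lower_bound J T f h \<and> norm h \<ge> \<epsilon>))"
proof -
  obtain M0 where M0: "\<And>t. t \<in> J \<Longrightarrow> norm (T t) \<le> M0"
    using assms(2) by (auto simp: bounded_semigroup_def bdd_above_def)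
  interpret bounded_positive_semigroup J T "max 1 M0"
  proof
    show "norm (T t x) \<le> max 1 M0 * norm x" if "t \<in> J" for t x
      using M0[OF that] by (intro order_trans[OF norm_blinfun] mult_right_mono) simp_all
  qed (use assms in \<open>auto simp: bounded_semigroup_def operator_semigroup_def
        positive_semigroup_def\<close>)
  show ?thesis
  proof (intro iffI allI impI)
    fix f :: 'a
    assume "\<exists>P. converges_strongly_to J T P \<and> (\<forall>f\<ge>0. \<epsilon> * norm f \<le> norm (P f))"
    then obtain P where P: "converges_strongly_to J T P" "\<And>f. 0 \<le> f \<Longrightarrow> \<epsilon> * norm f \<le> norm (P f)"
      by blast
    assume f: "0 \<le> f" "norm f = 1"
    have "is_lower_bound J T f (P f)"
      using P(1) f(1) by (intro limit_is_lower_bound) (simp_all add: converges_strongly_to_iff)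
    then show "\<exists>h. is_lower_bound J T f h \<and> \<epsilon> \<le> norm h"
      using P(2)[OF f(1)] f(2) by auto
  next
    assume "\<forall>f\<ge>0. norm f = 1 \<longrightarrow> (\<exists>h. is_lower_bound J T f h \<and> \<epsilon> \<le> norm h)"
    then have large: "\<exists>h. is_lower_bound J T f h \<and> \<epsilon> * norm f \<le> norm h" if "0 \<le> f" for f
      using lower_bound_of_normalised[OF _ that] by blast
    have fixed: "\<forall>f\<ge>0. \<exists>k. is_lower_bound J T f k \<and> (\<forall>s\<in>J. T s k = k) \<and> \<epsilon>\<^sup>2 * norm f \<le> norm k"
    proof (intro allI impI)
      fix f :: 'a
      assume "0 \<le> f"
      obtain k where "is_lower_bound J T f k" "\<And>s. s \<in> J \<Longrightarrow> T s k = k" "\<epsilon>\<^sup>2 * norm f \<le> norm k"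
        using fixed_lower_bound[of \<epsilon> f] assms(4) large \<open>0 \<le> f\<close> by metis
      then show "\<exists>k. is_lower_bound J T f k \<and> (\<forall>s\<in>J. T s k = k) \<and> \<epsilon>\<^sup>2 * norm f \<le> norm k"
        by (intro exI[of _ k]) simp
    qed
    have "\<exists>l. ((\<lambda>t. T t f) \<longlongrightarrow> l) (at_top_in J)" if "0 \<le> f" for f
      using orbit_converges[OF fixed _ that] assms(4) by auto
    then obtain P where P: "converges_strongly_to J T P"
      using strongly_convergent by blast
    have "\<epsilon> * norm f \<le> norm (P f)" if "0 \<le> f" for f
    proof -
      obtain h where h: "is_lower_bound J T f h" "\<epsilon> * norm f \<le> norm h"
        using large[OF \<open>0 \<le> f\<close>] by blast
      then have "h \<le> P f"
        using P lower_bound_le_limit unfolding converges_strongly_to_iff by blast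
      then have "norm h \<le> norm (P f)"
        using h(1) by (intro norm_mono_nonneg) (auto simp: is_lower_bound_def)
      then show ?thesis
        using h(2) by linarith
    qed
    with P show "\<exists>P. converges_strongly_to J T P \<and> (\<forall>f\<ge>0. \<epsilon> * norm f \<le> norm (P f))"
      by blast
  qed
qed

end
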